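(* Let $E$ be a finite set with $|E|\ge 2$, let $K\subseteq\mathbb R_+^E$ be a closed convex cone, let $P=K\cap[0,1]^E$, let $c\in\mathbb R^E$ and assume $\alpha:=\max\{c^\top y:y\in P\}>0$. A nonempty set $J\subseteq E$ satisfies the $\infty$-bottleneck property if and only if it satisfies the $|J|$-bottleneck property. Consequently, $\mathcal B_\infty=\mathcal B_{|E|-1}$.
   Context: For $y\in\mathbb R_+^E$, $\operatorname{supp}(y)=\{e\in E:y_e>0\}$. For an integer $\ell\ge1$, a set $J\subseteq E$ satisfies the $\ell$-bottleneck property if for all $z^1,\dots,z^\ell\in P$: $\left(\bigcap_{i=1}^\ell\operatorname{supp}(z^i)\right)\cap J=\emptyset$ implies $\sum_{i=1}^\ell c^\top z^i\le\alpha(\ell-1)$. $\mathcal B_\ell$ is the family of all subsets of $E$ with the $\ell$-bottleneck property. $J$ satisfies the $\infty$-bottleneck property if it satisfies the $\ell$-bottleneck property for every integer $\ell\ge1$; $\mathcal B_\infty$ is the family of such sets. *)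

theory Defs
  imports "HOL-Analysis.Analysis"
begin

(* The ground set E is the finite index type 'e, so subsets of E have type 'e set. *)

definition nonneg_orthant :: "(real ^ 'e) set" where
  "nonneg_orthant = {y. \<forall>e. 0 \<le> y $ e}"

definition supp :: "real ^ 'e \<Rightarrow> 'e set" where
  "supp y = {e. 0 < y $ e}"

definition cube_part :: "(real ^ 'e) set \<Rightarrow> (real ^ 'e) set" where
  "cube_part K = {y \<in> K. \<forall>e. 0 \<le> y $ e \<and> y $ e \<le> 1}"

(* A genuine maximum (an attained value), not a supremum.  It exists whenever K is closed
   and nonempty, because cube_part K is then compact, and nonempty if K is a cone. *)
definition max_val :: "(real ^ 'e::finite) set \<Rightarrow> real ^ 'e \<Rightarrow> real" where
  "max_val K c = (GREATEST a. a \<in> (\<lambda>y. c \<bullet> y) ` cube_part K)"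

(* Only meaningful for l >= 1.  The points z 1, ..., z l need not be distinct; values of z
   outside {1..l} are irrelevant. *)
definition bottleneck ::
    "(real ^ 'e::finite) set \<Rightarrow> real ^ 'e \<Rightarrow> nat \<Rightarrow> 'e set \<Rightarrow> bool" where
  "bottleneck K c l J \<longleftrightarrow>
     (\<forall>z :: nat \<Rightarrow> real ^ 'e.
        (\<forall>i\<in>{1..l}. z i \<in> cube_part K) \<longrightarrow>
        (\<Inter>i\<in>{1..l}. supp (z i)) \<inter> J = {} \<longrightarrow>
        (\<Sum>i=1..l. c \<bullet> z i) \<le> max_val K c * (real l - 1))"

definition bottleneck_inf ::
    "(real ^ 'e::finite) set \<Rightarrow> real ^ 'e \<Rightarrow> 'e set \<Rightarrow> bool" where
  "bottleneck_inf K c J \<longleftrightarrow> (\<forall>l\<ge>1. bottleneck K c l J)"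

definition bottleneck_family ::
    "(real ^ 'e::finite) set \<Rightarrow> real ^ 'e \<Rightarrow> nat \<Rightarrow> 'e set set" where
  "bottleneck_family K c l = {J. bottleneck K c l J}"

definition bottleneck_family_inf ::
    "(real ^ 'e::finite) set \<Rightarrow> real ^ 'e \<Rightarrow> 'e set set" where
  "bottleneck_family_inf K c = {J. bottleneck_inf K c J}"

end

theory Submission
  imports Defs
begin

text \<open>
  Write \<open>\<alpha>\<close> for the maximum of \<open>c\<close> over \<open>P\<close>. The bottleneck properties of a fixed set \<open>J\<close> form a
  decreasing chain in \<open>\<ell>\<close>, because a family of \<open>\<ell>\<close> points may be padded with maximisers, each of
  which adds exactly \<open>\<alpha>\<close> to both sides of the inequality. The chain is constant from \<open>\<ell> = |J|\<close> on:
  if the common support of a family misses \<open>J\<close>, then one point for each \<open>j \<in> J\<close>, vanishing at \<open>j\<close>,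
  already witnesses this, and every further point contributes at most \<open>\<alpha>\<close>. So the
  \<open>|J|\<close>-bottleneck property decides the \<open>\<infinity>\<close>-bottleneck property.

  For the bound \<open>|E| - 1\<close> this settles every \<open>J \<noteq> E\<close>. The whole set \<open>E\<close> has all the properties
  with \<open>\<ell> \<ge> 1\<close>, and this is where the cone enters: if no coordinate lies in all \<open>\<ell>\<close> supports, the
  sum of the points has all coordinates at most \<open>\<ell> - 1\<close>, so dividing it by \<open>\<ell> - 1\<close> gives a point
  of \<open>P\<close>. For \<open>\<ell> = 1\<close>, where this division is impossible, the only point is \<open>0\<close>.
\<close>

lemma cube_part_eq_Int_cbox: "cube_part K = K \<inter> cbox 0 1"
  by (auto simp: cube_part_def mem_box_cart)

lemma max_val_attained:
  fixes K :: "(real ^ 'e::finite) set"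
  assumes "closed K" and "cube_part K \<noteq> {}"
  obtains y where "y \<in> cube_part K" and "c \<bullet> y = max_val K c"
    and "\<And>z. z \<in> cube_part K \<Longrightarrow> c \<bullet> z \<le> max_val K c"
proof -
  have "compact (cube_part K)"
    unfolding cube_part_eq_Int_cbox using assms(1) by (intro closed_Int_compact compact_cbox)
  moreover have "continuous_on (cube_part K) (\<lambda>y. c \<bullet> y)"
    by (intro continuous_intros)
  ultimately obtain y where y: "y \<in> cube_part K" "\<And>z. z \<in> cube_part K \<Longrightarrow> c \<bullet> z \<le> c \<bullet> y"
    using continuous_attains_sup[of "cube_part K" "\<lambda>y. c \<bullet> y"] assms(2) by blast
  have "max_val K c = c \<bullet> y"
    unfolding max_val_def using y by (intro Greatest_equality) auto
  then show thesis
    using y by (intro that[of y]) auto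
qed

lemma convex_cone_sum:
  assumes "convex_cone K" and "\<And>i. i \<in> I \<Longrightarrow> f i \<in> K"
  shows "sum f I \<in> K"
  using assms(2)
  by (induction I rule: infinite_finite_induct)
    (auto intro: convex_cone_add convex_cone_contains_0 assms(1))

text \<open>The order of the points is immaterial, so any finite index set of the right size will do.\<close>

lemma bottleneck_finite_index:
  assumes "bottleneck K c l J" and "finite I" and "card I = l"
    and "\<And>i. i \<in> I \<Longrightarrow> z i \<in> cube_part K" and "(\<Inter>i\<in>I. supp (z i)) \<inter> J = {}"
  shows "(\<Sum>i\<in>I. c \<bullet> z i) \<le> max_val K c * (real l - 1)"
proof -
  obtain h where h: "bij_betw h {1..l} I"
    using assms(2,3) finite_same_card_bij[of "{1..l}" I] by auto
  then have I: "h ` {1..l} = I"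
    by (simp add: bij_betw_def)
  have "(\<Inter>i\<in>{1..l}. supp (z (h i))) = (\<Inter>i\<in>I. supp (z i))"
    unfolding I[symmetric] by simp
  then have "(\<Inter>i\<in>{1..l}. supp (z (h i))) \<inter> J = {}"
    using assms(5) by (simp only:)
  moreover have "\<forall>i\<in>{1..l}. z (h i) \<in> cube_part K"
    using assms(4) I by blast
  ultimately have "(\<Sum>i=1..l. c \<bullet> z (h i)) \<le> max_val K c * (real l - 1)"
    using assms(1)[unfolded bottleneck_def, THEN spec, of "\<lambda>i. z (h i)"] by blast
  then show ?thesis
    using sum.reindex_bij_betw[OF h, of "\<lambda>i. c \<bullet> z i"] by simp
qed

text \<open>Padding with copies of a maximiser can only shrink the common support.\<close>

lemma bottleneck_antimono:
  assumes "bottleneck K c m J" and "l \<le> m"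
    and y: "y \<in> cube_part K" "c \<bullet> y = max_val K c"
  shows "bottleneck K c l J"
  unfolding bottleneck_def
proof (intro allI impI)
  fix z :: "nat \<Rightarrow> real ^ 'a"
  assume z: "\<forall>i\<in>{1..l}. z i \<in> cube_part K" and disj: "(\<Inter>i\<in>{1..l}. supp (z i)) \<inter> J = {}"
  define w where "w i = (if i \<le> l then z i else y)" for i
  have "(\<Inter>i\<in>{1..m}. supp (w i)) \<subseteq> (\<Inter>i\<in>{1..l}. supp (w i))"
    using \<open>l \<le> m\<close> by (intro INF_superset_mono) auto
  also have "\<dots> = (\<Inter>i\<in>{1..l}. supp (z i))"
    by (simp add: w_def)
  finally have w_disj: "(\<Inter>i\<in>{1..m}. supp (w i)) \<inter> J = {}"
    using disj Int_mono[OF _ order_refl[of J]] by (metis subset_empty)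
  have "w i \<in> cube_part K" if "i \<in> {1..m}" for i
    using that z y(1) by (simp add: w_def)
  then have "(\<Sum>i=1..m. c \<bullet> w i) \<le> max_val K c * (real m - 1)"
    by (intro bottleneck_finite_index[OF assms(1) _ _ _ w_disj]) simp_all
  moreover have "(\<Sum>i=1..m. c \<bullet> w i) = (\<Sum>i=1..l. c \<bullet> w i) + (\<Sum>i=Suc l..m. c \<bullet> w i)"
    using sum.ub_add_nat[of 1 l "\<lambda>i. c \<bullet> w i" "m - l"] \<open>l \<le> m\<close> by simp
  moreover have "(\<Sum>i=Suc l..m. c \<bullet> w i) = max_val K c * (real m - real l)"
    using \<open>l \<le> m\<close> y by (simp add: w_def of_nat_diff)
  moreover have "(\<Sum>i=1..l. c \<bullet> w i) = (\<Sum>i=1..l. c \<bullet> z i)"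
    by (simp add: w_def)
  ultimately show "(\<Sum>i=1..l. c \<bullet> z i) \<le> max_val K c * (real l - 1)"
    by (simp add: algebra_simps)
qed

text \<open>
  For each \<open>j \<in> J\<close> some point vanishes at \<open>j\<close>. Any \<open>m\<close> points that include these at most \<open>|J|\<close>
  witnesses obey the hypothesis; each of the others contributes at most the maximum.
\<close>

lemma bottleneck_mono_above_card:
  assumes "bottleneck K c m J" and "finite J" and "card J \<le> m" and "m \<le> l"
    and bound: "\<And>x. x \<in> cube_part K \<Longrightarrow> c \<bullet> x \<le> max_val K c"
  shows "bottleneck K c l J"
  unfolding bottleneck_def
proof (intro allI impI)
  fix z :: "nat \<Rightarrow> real ^ 'a"
  assume z: "\<forall>i\<in>{1..l}. z i \<in> cube_part K" and disj: "(\<Inter>i\<in>{1..l}. supp (z i)) \<inter> J = {}"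
  have "\<forall>j\<in>J. \<exists>i\<in>{1..l}. j \<notin> supp (z i)"
    using disj by blast
  then obtain f where f: "\<And>j. j \<in> J \<Longrightarrow> f j \<in> {1..l} \<and> j \<notin> supp (z (f j))"
    by metis
  have "card (f ` J) \<le> m"
    using card_image_le[OF \<open>finite J\<close>, of f] \<open>card J \<le> m\<close> by simp
  moreover have "m \<le> card {1..l}"
    using \<open>m \<le> l\<close> by simp
  moreover have "f ` J \<subseteq> {1..l}"
    using f by blast
  ultimately obtain I where I: "f ` J \<subseteq> I" "I \<subseteq> {1..l}" "card I = m"
    using exists_subset_between[of "f ` J" m "{1..l}"] finite_atLeastAtMost by blast
  have "finite I"
    using I(2) finite_subset by blast
  have "(\<Inter>i\<in>I. supp (z i)) \<inter> J = {}"
    using f I(1) by blast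
  then have "(\<Sum>i\<in>I. c \<bullet> z i) \<le> max_val K c * (real m - 1)"
    using z I \<open>finite I\<close> by (intro bottleneck_finite_index[OF assms(1)]) auto
  moreover have "(\<Sum>i\<in>{1..l} - I. c \<bullet> z i) \<le> (\<Sum>i\<in>{1..l} - I. max_val K c)"
    using z bound by (intro sum_mono) auto
  moreover have "card ({1..l} - I) = l - m"
    using I \<open>finite I\<close> by (simp add: card_Diff_subset)
  moreover have "(\<Sum>i=1..l. c \<bullet> z i) = (\<Sum>i\<in>{1..l} - I. c \<bullet> z i) + (\<Sum>i\<in>I. c \<bullet> z i)"
    using I(2) by (intro sum.subset_diff) auto
  ultimately show "(\<Sum>i=1..l. c \<bullet> z i) \<le> max_val K c * (real l - 1)"
    using \<open>m \<le> l\<close> by (simp add: of_nat_diff algebra_simps)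
qed

text \<open>
  Each coordinate vanishes at one of the points, so dividing their sum by \<open>l - 1\<close> keeps it in the
  unit cube, while the cone \<open>K\<close> is closed under sums and nonnegative scaling.
\<close>

lemma bottleneck_UNIV:
  assumes "convex_cone K" and "1 \<le> l"
    and bound: "\<And>x. x \<in> cube_part K \<Longrightarrow> c \<bullet> x \<le> max_val K c"
  shows "bottleneck K c l UNIV"
  unfolding bottleneck_def
proof (intro allI impI)
  fix z :: "nat \<Rightarrow> real ^ 'a"
  assume z: "\<forall>i\<in>{1..l}. z i \<in> cube_part K" and "(\<Inter>i\<in>{1..l}. supp (z i)) \<inter> UNIV = {}"
  then have gap: "\<exists>k\<in>{1..l}. e \<notin> supp (z k)" for e
    by blast
  define s where "s = (\<Sum>i=1..l. z i)"
  have s_comp: "s $ e = (\<Sum>i=1..l. z i $ e)" for e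
    by (simp add: s_def)
  have s_nonneg: "0 \<le> s $ e" for e
    using z unfolding s_comp by (intro sum_nonneg) (auto simp: cube_part_def)
  have s_le: "s $ e \<le> real l - 1" for e
  proof -
    obtain k where k: "k \<in> {1..l}" "e \<notin> supp (z k)"
      using gap by blast
    then have "z k \<in> cube_part K" "\<not> 0 < z k $ e"
      using z by (auto simp: supp_def)
    then have "z k $ e = 0"
      by (auto simp: cube_part_def order_antisym not_less)
    then have "s $ e = (\<Sum>i\<in>{1..l} - {k}. z i $ e)"
      unfolding s_comp using k(1) by (simp add: sum.remove)
    also have "\<dots> \<le> (\<Sum>i\<in>{1..l} - {k}. 1)"
      using z by (intro sum_mono) (auto simp: cube_part_def)
    also have "\<dots> = real l - 1"
      using k(1) \<open>1 \<le> l\<close> by (simp add: of_nat_diff)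
    finally show ?thesis .
  qed
  have "c \<bullet> s \<le> max_val K c * (real l - 1)"
  proof (cases "l = 1")
    case True
    then have "s = 0"
      using s_nonneg s_le by (simp add: vec_eq_iff order_antisym)
    then show ?thesis
      using True by simp
  next
    case False
    then have pos: "0 < real l - 1"
      using \<open>1 \<le> l\<close> by simp
    have "s \<in> K"
      unfolding s_def using z \<open>convex_cone K\<close>
      by (intro convex_cone_sum) (auto simp: cube_part_def)
    then have "(1 / (real l - 1)) *\<^sub>R s \<in> K"
      using pos \<open>convex_cone K\<close> by (intro convex_cone_scaleR) auto
    then have "(1 / (real l - 1)) *\<^sub>R s \<in> cube_part K"
      using pos s_nonneg s_le by (auto simp: cube_part_def divide_simps)
    from bound[OF this] show ?thesis
      using pos by (simp add: divide_simps)
  qed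
  then show "(\<Sum>i=1..l. c \<bullet> z i) \<le> max_val K c * (real l - 1)"
    by (simp add: s_def inner_sum_right)
qed

theorem theorem2p7:
  fixes K :: "(real ^ 'e::finite) set" and c :: "real ^ 'e"
  assumes "2 \<le> CARD('e)"
    and "closed K" and "convex_cone K" and "K \<subseteq> nonneg_orthant"
    and "0 < max_val K c"
  shows "(\<forall>J :: 'e set. J \<noteq> {} \<longrightarrow> (bottleneck_inf K c J \<longleftrightarrow> bottleneck K c (card J) J))
    \<and> bottleneck_family_inf K c = bottleneck_family K c (CARD('e) - 1)"
proof -
  have "0 \<in> cube_part K"
    using convex_cone_contains_0[OF assms(3)] by (simp add: cube_part_def)
  then obtain y where y: "y \<in> cube_part K" "c \<bullet> y = max_val K c"
    and bound: "\<And>x. x \<in> cube_part K \<Longrightarrow> c \<bullet> x \<le> max_val K c"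
    using max_val_attained[OF assms(2), of c] by blast
  have stable: "bottleneck_inf K c J" if "bottleneck K c m J" "card J \<le> m" for J m
    unfolding bottleneck_inf_def
  proof (intro allI impI)
    fix l :: nat
    show "bottleneck K c l J"
    proof (cases "l \<le> m")
      case True
      with that(1) show ?thesis using y by (rule bottleneck_antimono)
    next
      case False
      then show ?thesis
        using that bound by (intro bottleneck_mono_above_card[of K c m J l]) auto
    qed
  qed
  have "bottleneck_inf K c J \<longleftrightarrow> bottleneck K c (card J) J" if "J \<noteq> {}" for J
  proof -
    have "1 \<le> card J"
      using that by (simp add: Suc_le_eq card_gt_0_iff)
    then show ?thesis
      using stable[of "card J" J] unfolding bottleneck_inf_def by blast
  qed
  moreover have "bottleneck_inf K c J \<longleftrightarrow> bottleneck K c (CARD('e) - 1) J" for J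
  proof
    assume "bottleneck_inf K c J"
    then show "bottleneck K c (CARD('e) - 1) J"
      using assms(1) by (simp add: bottleneck_inf_def)
  next
    assume J: "bottleneck K c (CARD('e) - 1) J"
    show "bottleneck_inf K c J"
    proof (cases "J = UNIV")
      case True
      then show ?thesis
        using bottleneck_UNIV[OF assms(3) _ bound] by (simp add: bottleneck_inf_def)
    next
      case False
      then have "card J < CARD('e)"
        by (intro psubset_card_mono) auto
      with J show ?thesis
        by (intro stable[of "CARD('e) - 1"]) auto
    qed
  qed
  ultimately show ?thesis
    by (simp add: bottleneck_family_inf_def bottleneck_family_def)
qed

end
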